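(* Let $R$ be a ring and $\alpha$ an endomorphism of $R$. Then the following conditions are equivalent: (i) the skew polynomial ring $R[x;\alpha]$ is a reduced left Archimedean ring; (ii) $R[x;\alpha]$ is a left Archimedean domain; (iii) $R$ is a left Archimedean domain and $\alpha$ is injective.
   Context: Rings are associative with unity $1\neq 0$, not necessarily commutative; endomorphisms are (unital) ring endomorphisms. $U(A)$ denotes the group of units (two-sided invertible elements) of a ring $A$. $\mathbb{N}$ is the set of positive integers. A ring $A$ is left Archimedean if $\bigcap_{n\in\mathbb{N}} a^nA = 0$ for every $a\in A\setminus U(A)$. A ring is reduced if it has no nonzero nilpotent elements. A domain is a (not necessarily commutative) ring in which the product of any two nonzero elements is nonzero. The skew polynomial ring $R[x;\alpha]$ consists of polynomials over $R$ in the variable $x$ with coefficients written on the left of powers of $x$, with term-wise addition and with multiplication subject to the relation $xa=\alpha(a)x$ for $a\in R$. *)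

theory Defs
  imports "HOL-Algebra.UnivPoly"
begin

text \<open>The HOL-Algebra locale \<^locale>\<open>ring\<close> admits the zero ring and \<^locale>\<open>domain\<close> is commutative,
  so rings with \<open>\<one> \<noteq> \<zero>\<close> and not necessarily commutative domains are introduced separately.\<close>

locale nonzero_ring = ring +
  assumes one_neq_zero: "\<one> \<noteq> \<zero>"

locale nc_domain = nonzero_ring +
  assumes nc_integral:
    "\<lbrakk>a \<in> carrier R; b \<in> carrier R; a \<noteq> \<zero>; b \<noteq> \<zero>\<rbrakk> \<Longrightarrow> a \<otimes> b \<noteq> \<zero>"

locale reduced_ring = nonzero_ring +
  assumes reduced:
    "\<lbrakk>a \<in> carrier R; a [^] (n::nat) = \<zero>\<rbrakk> \<Longrightarrow> a = \<zero>"

text \<open>\<open>a [^] n <# carrier R\<close> is the principal right ideal generated by the \<open>n\<close>-th power of \<open>a\<close>.\<close>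

locale left_archimedean_ring = nonzero_ring +
  assumes left_archimedean:
    "a \<in> carrier R - Units R \<Longrightarrow> (\<Inter>n\<in>{1::nat..}. a [^] n <# carrier R) = {\<zero>}"

text \<open>As for \<^const>\<open>UP\<close>, a polynomial is its finitely supported coefficient sequence; the sequence \<open>p\<close>
  stands for \<open>\<Sum>i. p i \<cdot> x\<^sup>i\<close>, with coefficients on the left. The relation \<open>x \<cdot> a = \<alpha> a \<cdot> x\<close> gives
  \<open>(a \<cdot> x\<^sup>i) \<cdot> (b \<cdot> x\<^sup>j) = a \<cdot> \<alpha>\<^sup>i b \<cdot> x\<^sup>i\<^sup>+\<^sup>j\<close>.\<close>

definition skew_poly_ring ::
    "('a, 'm) ring_scheme \<Rightarrow> ('a \<Rightarrow> 'a) \<Rightarrow> (nat \<Rightarrow> 'a) ring"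
  where "skew_poly_ring R \<alpha> = \<lparr>
    carrier = up R,
    mult = (\<lambda>p q n. \<Oplus>\<^bsub>R\<^esub>i\<in>{..n}. p i \<otimes>\<^bsub>R\<^esub> (\<alpha> ^^ i) (q (n - i))),
    one = (\<lambda>n. if n = 0 then \<one>\<^bsub>R\<^esub> else \<zero>\<^bsub>R\<^esub>),
    zero = (\<lambda>n. \<zero>\<^bsub>R\<^esub>),
    add = (\<lambda>p q n. p n \<oplus>\<^bsub>R\<^esub> q n)\<rparr>"

definition skew_monom :: "('a, 'm) ring_scheme \<Rightarrow> 'a \<Rightarrow> nat \<Rightarrow> nat \<Rightarrow> 'a"
  where "skew_monom R a k = (\<lambda>n. if n = k then a else \<zero>\<^bsub>R\<^esub>)"

context ring
begin

lemma finsum_triangle: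
  assumes "\<And>i l. g i l \<in> carrier R"
  shows "(\<Oplus>j\<in>{..k::nat}. \<Oplus>i\<in>{..j}. g i (j - i)) = (\<Oplus>j\<in>{..k}. \<Oplus>i\<in>{..k - j}. g j i)"
proof (induction k)
  case 0
  then show ?case using assms by simp
next
  case (Suc k)
  have "(\<Oplus>j\<in>{..k}. \<Oplus>i\<in>{..Suc k - j}. g j i)
      = (\<Oplus>j\<in>{..k}. g j (Suc k - j) \<oplus> (\<Oplus>i\<in>{..k - j}. g j i))"
    using assms by (intro finsum_cong') (auto simp: Suc_diff_le Pi_def)
  also have "\<dots> = (\<Oplus>j\<in>{..k}. g j (Suc k - j)) \<oplus> (\<Oplus>j\<in>{..k}. \<Oplus>i\<in>{..k - j}. g j i)"
    using assms by (intro finsum_addf) (auto simp: Pi_def)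
  finally show ?case
    using Suc.IH assms by (simp add: Pi_def a_assoc)
qed

lemma funpow_ring_hom: "\<alpha> \<in> ring_hom R R \<Longrightarrow> \<alpha> ^^ i \<in> ring_hom R R"
  by (induction i) (auto simp: ring_hom_def Pi_def)

lemma endo_finsum:
  assumes "h \<in> ring_hom R R" "finite A" "f \<in> A \<rightarrow> carrier R"
  shows "h (finsum R f A) = (\<Oplus>i\<in>A. h (f i))"
proof -
  interpret h: ring_hom_ring R R h
    by (rule ring_hom_ringI2[OF ring_axioms ring_axioms assms(1)])
  show ?thesis using assms(2,3)
    by (induction A rule: finite_induct) (auto simp: Pi_def)
qed

lemma skew_mult_closed:
  assumes h: "\<alpha> \<in> ring_hom R R" and p: "p \<in> up R" and q: "q \<in> up R"
  shows "(\<lambda>n. \<Oplus>i\<in>{..n}. p i \<otimes> (\<alpha> ^^ i) (q (n - i))) \<in> up R"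
proof
  note hom = ring_hom_closed[OF funpow_ring_hom[OF h]]
  show "(\<Oplus>i\<in>{..n}. p i \<otimes> (\<alpha> ^^ i) (q (n - i))) \<in> carrier R" for n
    using p q hom by (intro finsum_closed) (auto simp: mem_upD)
  from p obtain m where m: "bound \<zero> m p" by auto
  from q obtain k where k: "bound \<zero> k q" by auto
  have "(\<Oplus>i\<in>{..n}. p i \<otimes> (\<alpha> ^^ i) (q (n - i))) = \<zero>" if n: "m + k < n" for n
  proof -
    have "p i \<otimes> (\<alpha> ^^ i) (q (n - i)) = \<zero>" for i
    proof (cases "m < i")
      case True
      then show ?thesis using bound.bound[OF m] q hom by (simp add: mem_upD)
    next
      case False
      then have "q (n - i) = \<zero>" using bound.bound[OF k] n by simp
      then show ?thesis
        using ring_hom_zero[OF funpow_ring_hom[OF h] ring_axioms ring_axioms] p by (simp add: mem_upD)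
    qed
    then show ?thesis by simp
  qed
  then have "bound \<zero> (m + k) (\<lambda>n. \<Oplus>i\<in>{..n}. p i \<otimes> (\<alpha> ^^ i) (q (n - i)))"
    by (simp add: bound_def)
  then show "\<exists>n. bound \<zero> n (\<lambda>n. \<Oplus>i\<in>{..n}. p i \<otimes> (\<alpha> ^^ i) (q (n - i)))" ..
qed

lemma skew_mult_assoc:
  assumes h: "\<alpha> \<in> ring_hom R R" and p: "p \<in> up R" and q: "q \<in> up R" and r: "r \<in> up R"
  shows "(\<Oplus>j\<in>{..n}. (\<Oplus>i\<in>{..j}. p i \<otimes> (\<alpha> ^^ i) (q (j - i))) \<otimes> (\<alpha> ^^ j) (r (n - j)))
       = (\<Oplus>j\<in>{..n}. p j \<otimes> (\<alpha> ^^ j) (\<Oplus>i\<in>{..n - j}. q i \<otimes> (\<alpha> ^^ i) (r (n - j - i))))"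
    (is "?L = ?R")
proof -
  note H = funpow_ring_hom[OF h]
  have cl: "p i \<in> carrier R" "q i \<in> carrier R" "r i \<in> carrier R"
    "a \<in> carrier R \<Longrightarrow> (\<alpha> ^^ i) a \<in> carrier R" for i a
    using p q r ring_hom_closed[OF H] by auto
  define g where "g i l = p i \<otimes> (\<alpha> ^^ i) (q l) \<otimes> (\<alpha> ^^ (i + l)) (r (n - i - l))" for i l
  have "?L = (\<Oplus>j\<in>{..n}. \<Oplus>i\<in>{..j}. g i (j - i))"
  proof (intro finsum_cong')
    fix j assume "j \<in> {..n}"
    have "(\<Oplus>i\<in>{..j}. p i \<otimes> (\<alpha> ^^ i) (q (j - i))) \<otimes> (\<alpha> ^^ j) (r (n - j))
        = (\<Oplus>i\<in>{..j}. p i \<otimes> (\<alpha> ^^ i) (q (j - i)) \<otimes> (\<alpha> ^^ j) (r (n - j)))"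
      using cl by (intro finsum_ldistr) auto
    also have "\<dots> = (\<Oplus>i\<in>{..j}. g i (j - i))"
      using cl by (intro finsum_cong') (auto simp: g_def)
    finally show "(\<Oplus>i\<in>{..j}. p i \<otimes> (\<alpha> ^^ i) (q (j - i))) \<otimes> (\<alpha> ^^ j) (r (n - j))
        = (\<Oplus>i\<in>{..j}. g i (j - i))" .
  qed (use cl in \<open>auto simp: g_def intro!: finsum_closed\<close>)
  also have "\<dots> = (\<Oplus>j\<in>{..n}. \<Oplus>i\<in>{..n - j}. g j i)"
    using cl by (intro finsum_triangle) (auto simp: g_def)
  also have "\<dots> = ?R"
  proof (intro finsum_cong' refl)
    fix j assume "j \<in> {..n}"
    have "p j \<otimes> (\<alpha> ^^ j) (\<Oplus>i\<in>{..n - j}. q i \<otimes> (\<alpha> ^^ i) (r (n - j - i)))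
        = p j \<otimes> (\<Oplus>i\<in>{..n - j}. (\<alpha> ^^ j) (q i \<otimes> (\<alpha> ^^ i) (r (n - j - i))))"
      using cl by (subst endo_finsum[OF H]) auto
    also have "\<dots> = (\<Oplus>i\<in>{..n - j}. p j \<otimes> (\<alpha> ^^ j) (q i \<otimes> (\<alpha> ^^ i) (r (n - j - i))))"
      using cl by (intro finsum_rdistr) auto
    also have "\<dots> = (\<Oplus>i\<in>{..n - j}. g j i)"
      using cl by (intro finsum_cong')
        (auto simp: g_def ring_hom_mult[OF H] m_assoc funpow_add)
    finally show "(\<Oplus>i\<in>{..n - j}. g j i)
        = p j \<otimes> (\<alpha> ^^ j) (\<Oplus>i\<in>{..n - j}. q i \<otimes> (\<alpha> ^^ i) (r (n - j - i)))" ..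
  qed (use cl in \<open>auto intro!: finsum_closed m_closed\<close>)
  finally show ?thesis .
qed

lemma finsum_single:
  assumes "k \<le> (n::nat)" "f k \<in> carrier R" "\<And>i. i \<noteq> k \<Longrightarrow> f i = \<zero>"
  shows "(\<Oplus>i\<in>{..n}. f i) = f k"
proof -
  have f: "f i \<in> carrier R" for i
    using assms(2,3) by (cases "i = k") auto
  have "(\<Oplus>i\<in>{..n}. f i) = (\<Oplus>i\<in>{..n}. if k = i then f i else \<zero>)"
    using f assms(3) by (intro finsum_cong') auto
  also have "\<dots> = f k"
    using assms(1) f by (intro add.finprod_singleton) auto
  finally show ?thesis .
qed

theorem skew_poly_ring_is_ring:
  assumes h: "\<alpha> \<in> ring_hom R R"
  shows "ring (skew_poly_ring R \<alpha>)"
proof (rule ringI)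
  note H = funpow_ring_hom[OF h]
  note cl = mem_upD ring_hom_closed[OF H]
  show "abelian_group (skew_poly_ring R \<alpha>)"
  proof (rule abelian_groupI)
    fix p assume "p \<in> carrier (skew_poly_ring R \<alpha>)"
    then have p: "p \<in> up R" by (simp add: skew_poly_ring_def)
    show "\<exists>q\<in>carrier (skew_poly_ring R \<alpha>). q \<oplus>\<^bsub>skew_poly_ring R \<alpha>\<^esub> p = \<zero>\<^bsub>skew_poly_ring R \<alpha>\<^esub>"
      using up_a_inv_closed[OF p] p
      by (intro bexI[of _ "\<lambda>i. \<ominus> p i"]) (auto simp: skew_poly_ring_def l_neg cl)
  qed (auto simp: skew_poly_ring_def up_add_closed cl a_ac bound_def intro!: ext)
  show "monoid (skew_poly_ring R \<alpha>)"
  proof (rule monoidI)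
    fix p assume "p \<in> carrier (skew_poly_ring R \<alpha>)"
    then have p: "p \<in> up R" by (simp add: skew_poly_ring_def)
    show "\<one>\<^bsub>skew_poly_ring R \<alpha>\<^esub> \<otimes>\<^bsub>skew_poly_ring R \<alpha>\<^esub> p = p"
    proof
      fix n
      show "(\<one>\<^bsub>skew_poly_ring R \<alpha>\<^esub> \<otimes>\<^bsub>skew_poly_ring R \<alpha>\<^esub> p) n = p n"
        unfolding skew_poly_ring_def using p cl
        by (simp, subst finsum_single[of 0]) auto
    qed
    show "p \<otimes>\<^bsub>skew_poly_ring R \<alpha>\<^esub> \<one>\<^bsub>skew_poly_ring R \<alpha>\<^esub> = p"
    proof
      fix n
      have "(\<Oplus>i\<in>{..n}. p i \<otimes> (\<alpha> ^^ i) (if n - i = 0 then \<one> else \<zero>))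
          = (\<Oplus>i\<in>{..n}. if n = i then p i else \<zero>)"
        using p
        by (intro finsum_cong')
           (auto simp: mem_upD ring_hom_one[OF H] ring_hom_zero[OF H ring_axioms ring_axioms])
      also have "\<dots> = p n"
        using p by (intro add.finprod_singleton) (auto simp: mem_upD)
      finally show "(p \<otimes>\<^bsub>skew_poly_ring R \<alpha>\<^esub> \<one>\<^bsub>skew_poly_ring R \<alpha>\<^esub>) n = p n"
        by (simp add: skew_poly_ring_def)
    qed
  qed (auto simp: skew_poly_ring_def skew_mult_closed[OF h] skew_mult_assoc[OF h] up_one_closed)
next
  note H = funpow_ring_hom[OF h]
  fix p q r
  assume "p \<in> carrier (skew_poly_ring R \<alpha>)" "q \<in> carrier (skew_poly_ring R \<alpha>)"
    "r \<in> carrier (skew_poly_ring R \<alpha>)"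
  then have c: "p i \<in> carrier R" "q i \<in> carrier R" "r i \<in> carrier R"
    "a \<in> carrier R \<Longrightarrow> (\<alpha> ^^ i) a \<in> carrier R" for i a
    by (auto simp: skew_poly_ring_def mem_upD ring_hom_closed[OF H])
  show "(p \<oplus>\<^bsub>skew_poly_ring R \<alpha>\<^esub> q) \<otimes>\<^bsub>skew_poly_ring R \<alpha>\<^esub> r
      = p \<otimes>\<^bsub>skew_poly_ring R \<alpha>\<^esub> r \<oplus>\<^bsub>skew_poly_ring R \<alpha>\<^esub> q \<otimes>\<^bsub>skew_poly_ring R \<alpha>\<^esub> r"
  proof
    fix n
    have "(\<Oplus>i\<in>{..n}. (p i \<oplus> q i) \<otimes> (\<alpha> ^^ i) (r (n - i)))
        = (\<Oplus>i\<in>{..n}. p i \<otimes> (\<alpha> ^^ i) (r (n - i)) \<oplus> q i \<otimes> (\<alpha> ^^ i) (r (n - i)))"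
      using c by (intro finsum_cong') (auto simp: l_distr)
    also have "\<dots> = (\<Oplus>i\<in>{..n}. p i \<otimes> (\<alpha> ^^ i) (r (n - i)))
        \<oplus> (\<Oplus>i\<in>{..n}. q i \<otimes> (\<alpha> ^^ i) (r (n - i)))"
      using c by (intro finsum_addf) auto
    finally show "((p \<oplus>\<^bsub>skew_poly_ring R \<alpha>\<^esub> q) \<otimes>\<^bsub>skew_poly_ring R \<alpha>\<^esub> r) n
      = (p \<otimes>\<^bsub>skew_poly_ring R \<alpha>\<^esub> r \<oplus>\<^bsub>skew_poly_ring R \<alpha>\<^esub> q \<otimes>\<^bsub>skew_poly_ring R \<alpha>\<^esub> r) n"
      by (simp add: skew_poly_ring_def)
  qed
  show "r \<otimes>\<^bsub>skew_poly_ring R \<alpha>\<^esub> (p \<oplus>\<^bsub>skew_poly_ring R \<alpha>\<^esub> q)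
      = r \<otimes>\<^bsub>skew_poly_ring R \<alpha>\<^esub> p \<oplus>\<^bsub>skew_poly_ring R \<alpha>\<^esub> r \<otimes>\<^bsub>skew_poly_ring R \<alpha>\<^esub> q"
  proof
    fix n
    have "(\<Oplus>i\<in>{..n}. r i \<otimes> (\<alpha> ^^ i) (p (n - i) \<oplus> q (n - i)))
        = (\<Oplus>i\<in>{..n}. r i \<otimes> (\<alpha> ^^ i) (p (n - i)) \<oplus> r i \<otimes> (\<alpha> ^^ i) (q (n - i)))"
      using c by (intro finsum_cong') (auto simp: r_distr ring_hom_add[OF H])
    also have "\<dots> = (\<Oplus>i\<in>{..n}. r i \<otimes> (\<alpha> ^^ i) (p (n - i)))
        \<oplus> (\<Oplus>i\<in>{..n}. r i \<otimes> (\<alpha> ^^ i) (q (n - i)))"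
      using c by (intro finsum_addf) auto
    finally show "(r \<otimes>\<^bsub>skew_poly_ring R \<alpha>\<^esub> (p \<oplus>\<^bsub>skew_poly_ring R \<alpha>\<^esub> q)) n
      = (r \<otimes>\<^bsub>skew_poly_ring R \<alpha>\<^esub> p \<oplus>\<^bsub>skew_poly_ring R \<alpha>\<^esub> r \<otimes>\<^bsub>skew_poly_ring R \<alpha>\<^esub> q) n"
      by (simp add: skew_poly_ring_def)
  qed
qed

lemma skew_monom_mult:
  assumes h: "\<alpha> \<in> ring_hom R R" and ab: "a \<in> carrier R" "b \<in> carrier R"
  shows "skew_monom R a i \<otimes>\<^bsub>skew_poly_ring R \<alpha>\<^esub> skew_monom R b j
       = skew_monom R (a \<otimes> (\<alpha> ^^ i) b) (i + j)"
proof
  fix n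
  note H = funpow_ring_hom[OF h]
  note z = ring_hom_zero[OF H ring_axioms ring_axioms] and cl = ring_hom_closed[OF H]
  let ?f = "\<lambda>k. skew_monom R a i k \<otimes> (\<alpha> ^^ k) (skew_monom R b j (n - k))"
  have "(\<Oplus>k\<in>{..n}. ?f k) = skew_monom R (a \<otimes> (\<alpha> ^^ i) b) (i + j) n"
  proof (cases "i \<le> n")
    case True
    have "(\<Oplus>k\<in>{..n}. ?f k) = ?f i"
      using True ab cl z by (intro finsum_single) (auto simp: skew_monom_def)
    then show ?thesis using True ab cl z by (auto simp: skew_monom_def)
  next
    case False
    have "(\<Oplus>k\<in>{..n}. ?f k) = (\<Oplus>k\<in>{..n}. \<zero>)"
      using False ab cl z by (intro finsum_cong') (auto simp: skew_monom_def)
    then show ?thesis using False by (auto simp: skew_monom_def)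
  qed
  then show "(skew_monom R a i \<otimes>\<^bsub>skew_poly_ring R \<alpha>\<^esub> skew_monom R b j) n
       = skew_monom R (a \<otimes> (\<alpha> ^^ i) b) (i + j) n"
    by (simp add: skew_poly_ring_def)
qed

corollary skew_commutation:
  assumes h: "\<alpha> \<in> ring_hom R R" and a: "a \<in> carrier R"
  shows "skew_monom R \<one> 1 \<otimes>\<^bsub>skew_poly_ring R \<alpha>\<^esub> skew_monom R a 0
       = skew_monom R (\<alpha> a) 0 \<otimes>\<^bsub>skew_poly_ring R \<alpha>\<^esub> skew_monom R \<one> 1"
  using a ring_hom_closed[OF h a] by (simp add: skew_monom_mult[OF h])

end

end

theory Submission
  imports Defs
begin

text \<open>The interesting implication is that a reduced left Archimedean \<open>R[x;\<alpha>]\<close> is a domain. In any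
  ring, \<open>a b = 0\<close> gives \<open>b = (1 - a)\<^sup>n b\<close> for all \<open>n\<close>, so in a left Archimedean ring \<open>1 - a\<close> is a
  unit whenever \<open>a\<close> is a left zero divisor. Two nonzero skew polynomials with product \<open>0\<close> have
  lowest terms \<open>c x\<^sup>i\<close> and \<open>d x\<^sup>j\<close> with product \<open>0\<close>, and reducedness allows inserting a further
  factor \<open>x\<close>; hence \<open>1 - y\<close> is a unit for \<open>y = c x\<^sup>i\<^sup>+\<^sup>1\<close>. Its inverse can only be the geometric series
  in \<open>y\<close>, which is not a polynomial because \<open>y\<close> is not nilpotent.\<close>

section \<open>Reduced rings, domains and zero divisors in general\<close>

lemma (in nc_domain) reduced_ring: "reduced_ring R"
proof
  fix a and n :: nat
  assume a: "a \<in> carrier R" and "a [^] n = \<zero>"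
  then show "a = \<zero>"
  proof (induction n)
    \<comment> \<open>The definition of a reduced ring admits the exponent 0, where
      \<open>a [^] 0 = \<one>\<close>, so this case rests on 1 being nonzero.\<close>
    case 0
    then show ?case using one_neq_zero by simp
  next
    case (Suc n)
    then show ?case using nc_integral[of "a [^] n" a] by auto
  qed
qed

text \<open>In a reduced ring vanishing products commute: (ba)(ba) = b(ab)a = 0 forces ba = 0. Then
  acb squares to ac(ba)cb = 0 and is itself 0.\<close>

lemma (in reduced_ring) zero_product_insert:
  assumes a: "a \<in> carrier R" and b: "b \<in> carrier R" and c: "c \<in> carrier R"
    and ab: "a \<otimes> b = \<zero>"
  shows "a \<otimes> c \<otimes> b = \<zero>"
proof -
  have square: "y = \<zero>" if "y \<in> carrier R" "y \<otimes> y = \<zero>" for y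
    using reduced[of y 2] that by (simp add: numeral_2_eq_2)
  have "(b \<otimes> a) \<otimes> (b \<otimes> a) = b \<otimes> (a \<otimes> b) \<otimes> a"
    using a b by (simp add: m_assoc)
  then have ba: "b \<otimes> a = \<zero>"
    using a b ab by - (rule square, simp_all)
  have "(a \<otimes> c \<otimes> b) \<otimes> (a \<otimes> c \<otimes> b) = a \<otimes> c \<otimes> (b \<otimes> a) \<otimes> (c \<otimes> b)"
    using a b c by (simp add: m_assoc)
  then show ?thesis
    using a b c ba by - (rule square, simp_all)
qed

lemma (in left_archimedean_ring) one_minus_left_zero_divisor:
  assumes a: "a \<in> carrier R" and b: "b \<in> carrier R" "b \<noteq> \<zero>" and ab: "a \<otimes> b = \<zero>"
  shows "\<one> \<ominus> a \<in> Units R"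
proof (rule ccontr)
  assume nonunit: "\<one> \<ominus> a \<notin> Units R"
  have c: "\<one> \<ominus> a \<in> carrier R" using a by simp
  have step: "(\<one> \<ominus> a) \<otimes> b = b"
    using a b ab by (simp add: minus_eq l_distr l_minus)
  have fix_b: "(\<one> \<ominus> a) [^] n \<otimes> b = b" for n :: nat
    by (induction n) (use c b step in \<open>simp_all add: m_assoc\<close>)
  have "b \<in> (\<Inter>n\<in>{1::nat..}. (\<one> \<ominus> a) [^] n <# carrier R)"
    unfolding l_coset_def using b by (auto intro!: bexI[of _ b] simp: fix_b)
  then show False
    using left_archimedean nonunit c b by blast
qed

section \<open>Coefficients and constants of R[x;\<alpha>]\<close>

locale skew_poly = nonzero_ring +
  fixes \<alpha> :: "'a \<Rightarrow> 'a"
  assumes endo: "\<alpha> \<in> ring_hom R R"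
begin

abbreviation S where "S \<equiv> skew_poly_ring R \<alpha>"

lemmas endo_pow = funpow_ring_hom[OF endo]
lemmas endo_pow_closed [simp] = ring_hom_closed[OF endo_pow]
lemmas endo_pow_zero [simp] = ring_hom_zero[OF endo_pow ring_axioms ring_axioms]
lemmas endo_pow_one [simp] = ring_hom_one[OF endo_pow]

text \<open>In a product the right-hand coefficient appears under a power of \<alpha>. Injectivity
  thus keeps products of lowest or leading coefficients nonzero when R is a domain.\<close>

lemma endo_pow_eq_zero_iff:
  assumes "inj_on \<alpha> (carrier R)" "a \<in> carrier R"
  shows "(\<alpha> ^^ i) a = \<zero> \<longleftrightarrow> a = \<zero>"
proof (induction i)
  case (Suc i)
  have "\<alpha> ((\<alpha> ^^ i) a) = \<alpha> \<zero> \<longleftrightarrow> (\<alpha> ^^ i) a = \<zero>"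
    using assms by (intro inj_on_eq_iff[of \<alpha> "carrier R"]) auto
  then show ?case using Suc endo_pow_zero[of 1] by simp
qed simp

lemma carrier_S: "carrier S = up R"
  and zero_S: "\<zero>\<^bsub>S\<^esub> = (\<lambda>n. \<zero>)"
  and one_S: "\<one>\<^bsub>S\<^esub> = skew_monom R \<one> 0"
  and add_S: "(p \<oplus>\<^bsub>S\<^esub> q) n = p n \<oplus> q n"
  by (simp_all add: skew_poly_ring_def skew_monom_def)

lemma coeff_closed [simp]: "p \<in> carrier S \<Longrightarrow> p n \<in> carrier R"
  by (simp add: carrier_S mem_upD)

sublocale S: nonzero_ring S
proof -
  interpret S: ring S by (rule skew_poly_ring_is_ring[OF endo])
  show "nonzero_ring S"
    by unfold_locales (use one_neq_zero in \<open>auto simp: one_S zero_S skew_monom_def fun_eq_iff\<close>)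
qed

lemma skew_monom_closed [simp]: "a \<in> carrier R \<Longrightarrow> skew_monom R a k \<in> carrier S"
  unfolding carrier_S skew_monom_def by (auto simp: up_def bound_def Pi_def intro!: exI[of _ k])

lemma skew_monom_coeff [simp]: "skew_monom R a k k = a"
  by (simp add: skew_monom_def)

lemma skew_monom_eq_zero_iff [simp]: "skew_monom R a k = \<zero>\<^bsub>S\<^esub> \<longleftrightarrow> a = \<zero>"
  by (auto simp: zero_S skew_monom_def fun_eq_iff)

lemma skew_monom_zero [simp]: "skew_monom R \<zero> k = \<zero>\<^bsub>S\<^esub>"
  by simp

text \<open>The assumption \<open>other\<close> kills every summand of the convolution except the
  one at i, since powers of \<alpha> fix 0. Monomial, lowest-term and leading-term products are all
  instances.\<close>

lemma coeff_mult:
  assumes p: "p \<in> carrier S" and q: "q \<in> carrier S"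
    and other: "\<And>k l. \<lbrakk>k + l = i + j; k \<noteq> i\<rbrakk> \<Longrightarrow> p k = \<zero> \<or> q l = \<zero>"
  shows "(p \<otimes>\<^bsub>S\<^esub> q) (i + j) = p i \<otimes> (\<alpha> ^^ i) (q j)"
proof -
  let ?f = "\<lambda>k. p k \<otimes> (\<alpha> ^^ k) (q (i + j - k))"
  have cl: "?f k \<in> carrier R" for k using p q by simp
  have "(p \<otimes>\<^bsub>S\<^esub> q) (i + j) = (\<Oplus>k\<in>{..i + j}. ?f k)"
    by (simp add: skew_poly_ring_def)
  also have "\<dots> = (\<Oplus>k\<in>{..i + j}. if i = k then ?f k else \<zero>)"
  proof (intro finsum_cong' refl)
    fix k assume "k \<in> {..i + j}"
    then have "i \<noteq> k \<Longrightarrow> p k = \<zero> \<or> q (i + j - k) = \<zero>"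
      using other[of k "i + j - k"] by auto
    then show "?f k = (if i = k then ?f k else \<zero>)" using p q by auto
  qed (use p q in auto)
  also have "\<dots> = ?f i"
    using add.finprod_singleton[of i "{..i + j}" ?f] p q by simp
  finally show ?thesis by simp
qed

lemma coeff_skew_monom_mult:
  assumes "c \<in> carrier R" "p \<in> carrier S"
  shows "(skew_monom R c m \<otimes>\<^bsub>S\<^esub> p) (m + n) = c \<otimes> (\<alpha> ^^ m) (p n)"
proof -
  have "skew_monom R c m k = \<zero>" if "k \<noteq> m" for k
    using that by (simp add: skew_monom_def)
  then show ?thesis
    using coeff_mult[of "skew_monom R c m" p m n] assms by simp
qed

lemma coeff_mult_0:
  assumes "p \<in> carrier S" "q \<in> carrier S"
  shows "(p \<otimes>\<^bsub>S\<^esub> q) 0 = p 0 \<otimes> q 0"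
  using coeff_mult[OF assms, of 0 0] by simp

lemma skew_monom_0_pow:
  assumes "a \<in> carrier R"
  shows "skew_monom R a 0 [^]\<^bsub>S\<^esub> (n::nat) = skew_monom R (a [^] n) 0"
  by (induction n) (use assms in \<open>simp_all add: one_S skew_monom_mult[OF endo]\<close>)

text \<open>An inverse of a constant might a priori be nonconstant. Taking constant terms is
  multiplicative, so the constant term of the inverse already inverts a in R.\<close>

lemma skew_monom_0_unit_iff:
  assumes a: "a \<in> carrier R"
  shows "skew_monom R a 0 \<in> Units S \<longleftrightarrow> a \<in> Units R"
proof
  assume "a \<in> Units R"
  then obtain b where b: "b \<in> carrier R" "a \<otimes> b = \<one>" "b \<otimes> a = \<one>"
    unfolding Units_def by blast
  show "skew_monom R a 0 \<in> Units S"
    unfolding Units_def mem_Collect_eq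
    by (intro conjI bexI[of _ "skew_monom R b 0"])
      (simp_all add: a b one_S skew_monom_mult[OF endo])
next
  assume "skew_monom R a 0 \<in> Units S"
  then obtain f where f: "f \<in> carrier S" "skew_monom R a 0 \<otimes>\<^bsub>S\<^esub> f = \<one>\<^bsub>S\<^esub>"
      "f \<otimes>\<^bsub>S\<^esub> skew_monom R a 0 = \<one>\<^bsub>S\<^esub>"
    unfolding Units_def by blast
  have "a \<otimes> f 0 = (skew_monom R a 0 \<otimes>\<^bsub>S\<^esub> f) 0"
    and "f 0 \<otimes> a = (f \<otimes>\<^bsub>S\<^esub> skew_monom R a 0) 0"
    using a f(1) by (simp_all add: coeff_mult_0)
  then have "a \<otimes> f 0 = \<one>" "f 0 \<otimes> a = \<one>"
    by (simp_all add: f(2,3) one_S)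
  then show "a \<in> Units R"
    using a coeff_closed[OF f(1), of 0] unfolding Units_def by blast
qed

section \<open>Lowest and leading terms of products\<close>

lemma lowest_coeff:
  assumes "p \<noteq> \<zero>\<^bsub>S\<^esub>"
  shows "\<exists>i. p i \<noteq> \<zero> \<and> (\<forall>k<i. p k = \<zero>)"
proof -
  have "\<exists>n. p n \<noteq> \<zero>" using assms by (auto simp: zero_S fun_eq_iff)
  then show ?thesis unfolding exists_least_iff[of "\<lambda>n. p n \<noteq> \<zero>"] by simp
qed

lemma coeffs_bounded:
  assumes "p \<in> carrier S"
  shows "\<exists>N. \<forall>k>N. p k = \<zero>"
  using assms unfolding carrier_S up_def bound_def by blast

lemma leading_coeff:
  assumes p: "p \<in> carrier S" "p \<noteq> \<zero>\<^bsub>S\<^esub>"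
  shows "\<exists>d. p d \<noteq> \<zero> \<and> (\<forall>k>d. p k = \<zero>)"
proof -
  obtain N where "\<forall>k>N. p k = \<zero>" using coeffs_bounded[OF p(1)] by blast
  then have bounded: "n \<le> N" if "p n \<noteq> \<zero>" for n using that not_le by blast
  obtain n where n: "p n \<noteq> \<zero>" using p by (auto simp: zero_S fun_eq_iff)
  let ?d = "GREATEST n. p n \<noteq> \<zero>"
  have "p ?d \<noteq> \<zero>"
    using n bounded by (rule GreatestI_nat)
  moreover have "p k = \<zero>" if "?d < k" for k
  proof (rule ccontr)
    assume "p k \<noteq> \<zero>"
    then have "k \<le> ?d" using bounded by (rule Greatest_le_nat)
    then show False using that by simp
  qed
  ultimately show ?thesis by blast
qed

lemma lowest_coeff_mult:
  assumes "p \<in> carrier S" "q \<in> carrier S"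
    and "\<And>k. k < i \<Longrightarrow> p k = \<zero>" "\<And>k. k < j \<Longrightarrow> q k = \<zero>"
  shows "(p \<otimes>\<^bsub>S\<^esub> q) (i + j) = p i \<otimes> (\<alpha> ^^ i) (q j)"
proof (rule coeff_mult)
  fix k l assume "k + l = i + j" "k \<noteq> i"
  then have "k < i \<or> l < j" by linarith
  then show "p k = \<zero> \<or> q l = \<zero>" using assms by blast
qed (rule assms)+

lemma leading_coeff_mult:
  assumes "p \<in> carrier S" "q \<in> carrier S"
    and "\<And>k. i < k \<Longrightarrow> p k = \<zero>" "\<And>k. j < k \<Longrightarrow> q k = \<zero>"
  shows "(p \<otimes>\<^bsub>S\<^esub> q) (i + j) = p i \<otimes> (\<alpha> ^^ i) (q j)"
    and "i + j < n \<Longrightarrow> (p \<otimes>\<^bsub>S\<^esub> q) n = \<zero>"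
proof -
  show "(p \<otimes>\<^bsub>S\<^esub> q) (i + j) = p i \<otimes> (\<alpha> ^^ i) (q j)"
  proof (rule coeff_mult)
    fix k l assume "k + l = i + j" "k \<noteq> i"
    then have "i < k \<or> j < l" by linarith
    then show "p k = \<zero> \<or> q l = \<zero>" using assms by blast
  qed (rule assms)+
  assume n: "i + j < n"
  \<comment> \<open>Writing n as i + (n - i) makes \<open>coeff_mult\<close> applicable above the
    top degree too. Its surviving summand vanishes because n - i exceeds j.\<close>
  have "(p \<otimes>\<^bsub>S\<^esub> q) (i + (n - i)) = p i \<otimes> (\<alpha> ^^ i) (q (n - i))"
  proof (rule coeff_mult)
    fix k l assume "k + l = i + (n - i)" "k \<noteq> i"
    then have "i < k \<or> j < l" using n by linarith
    then show "p k = \<zero> \<or> q l = \<zero>" using assms by blast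
  qed (rule assms)+
  then show "(p \<otimes>\<^bsub>S\<^esub> q) n = \<zero>" using n assms by simp
qed

section \<open>From reduced and left Archimedean to domain\<close>

lemma one_minus_skew_monom_unit:
  assumes c: "c \<in> carrier R" and m: "0 < m"
    and unit: "\<one>\<^bsub>S\<^esub> \<ominus>\<^bsub>S\<^esub> skew_monom R c m \<in> Units S"
  shows "\<exists>n::nat. skew_monom R c m [^]\<^bsub>S\<^esub> n = \<zero>\<^bsub>S\<^esub>"
proof -
  let ?y = "skew_monom R c m"
  have y: "?y \<in> carrier S" using c by simp
  obtain u where u: "u \<in> carrier S" and inv: "(\<one>\<^bsub>S\<^esub> \<ominus>\<^bsub>S\<^esub> ?y) \<otimes>\<^bsub>S\<^esub> u = \<one>\<^bsub>S\<^esub>"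
    using unit unfolding Units_def by blast
  \<comment> \<open>Splitting u this way turns (1 - y)u = 1 into the recursion u = 1 + yu, which is
    then read off coefficientwise.\<close>
  have "u = (\<one>\<^bsub>S\<^esub> \<ominus>\<^bsub>S\<^esub> ?y) \<otimes>\<^bsub>S\<^esub> u \<oplus>\<^bsub>S\<^esub> ?y \<otimes>\<^bsub>S\<^esub> u"
    using u y by (simp add: S.minus_eq S.l_distr S.l_minus S.a_assoc S.l_neg)
  then have rec: "u n = \<one>\<^bsub>S\<^esub> n \<oplus> (?y \<otimes>\<^bsub>S\<^esub> u) n" for n
    using inv add_S by metis
  \<comment> \<open>Left multiplication by y shifts exponents by m. As m is positive, 1 contributes
    nothing at m + n.\<close>
  have u_add: "u (m + n) = c \<otimes> (\<alpha> ^^ m) (u n)" for n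
    using rec[of "m + n"] m c u
    by (simp add: coeff_skew_monom_mult one_S skew_monom_def[of R "\<one>"])
  have "(?y \<otimes>\<^bsub>S\<^esub> u) 0 = \<zero>"
    using coeff_mult_0[OF y u] m u by (simp add: skew_monom_def)
  then have u_0: "u 0 = \<one>"
    using rec[of 0] by (simp add: one_S)
  \<comment> \<open>The multiples of m carry the geometric series: the coefficient of u at nm is
    that of \<open>y [^] n\<close>. The recursion multiplies by y on the left, so the induction
    peels off a left factor.\<close>
  have pow: "?y [^]\<^bsub>S\<^esub> n = skew_monom R (u (n * m)) (n * m)" for n :: nat
  proof (induction n)
    case (Suc n)
    then show ?case
      using c u y u_add[of "n * m"] by (simp only: S.nat_pow_Suc2) (simp add: skew_monom_mult[OF endo])
  qed (simp add: u_0 one_S)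
  obtain N where N: "\<And>k. N < k \<Longrightarrow> u k = \<zero>" using coeffs_bounded[OF u] by blast
  \<comment> \<open>The power N + 1 reads its coefficient beyond the bound N on the support of u,
    hence it is zero.\<close>
  have "N < Suc N * m" using m by (cases m) auto
  then have "?y [^]\<^bsub>S\<^esub> Suc N = \<zero>\<^bsub>S\<^esub>"
    using N pow[of "Suc N"] by (metis skew_monom_zero)
  then show ?thesis ..
qed

lemma reduced_left_archimedean_imp_domain:
  assumes "reduced_ring S" "left_archimedean_ring S"
  shows "nc_domain S"
proof
  interpret red: reduced_ring S by fact
  interpret arch: left_archimedean_ring S by fact
  fix p q assume p: "p \<in> carrier S" "p \<noteq> \<zero>\<^bsub>S\<^esub>" and q: "q \<in> carrier S" "q \<noteq> \<zero>\<^bsub>S\<^esub>"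
  show "p \<otimes>\<^bsub>S\<^esub> q \<noteq> \<zero>\<^bsub>S\<^esub>"
  proof
    assume pq: "p \<otimes>\<^bsub>S\<^esub> q = \<zero>\<^bsub>S\<^esub>"
    obtain i where i: "p i \<noteq> \<zero>" "\<And>k. k < i \<Longrightarrow> p k = \<zero>" using lowest_coeff[OF p(2)] by blast
    obtain j where j: "q j \<noteq> \<zero>" "\<And>k. k < j \<Longrightarrow> q k = \<zero>" using lowest_coeff[OF q(2)] by blast
    let ?a = "skew_monom R (p i) i" and ?b = "skew_monom R (q j) j" and ?x = "skew_monom R \<one> 1"
    \<comment> \<open>This is the lowest term of p times x. The extra x makes the exponent positive
      even when i = 0, as \<open>one_minus_skew_monom_unit\<close> requires.\<close>
    let ?y = "skew_monom R (p i) (Suc i)"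
    have "p i \<otimes> (\<alpha> ^^ i) (q j) = \<zero>"
      using lowest_coeff_mult[of p q i j] p q i j pq by (simp add: zero_S)
    then have "?a \<otimes>\<^bsub>S\<^esub> ?b = \<zero>\<^bsub>S\<^esub>"
      using p q by (simp add: skew_monom_mult[OF endo])
    then have "?a \<otimes>\<^bsub>S\<^esub> ?x \<otimes>\<^bsub>S\<^esub> ?b = \<zero>\<^bsub>S\<^esub>"
      using p q by (intro red.zero_product_insert) auto
    moreover have "?a \<otimes>\<^bsub>S\<^esub> ?x = ?y"
      using p by (simp add: skew_monom_mult[OF endo])
    ultimately have "\<one>\<^bsub>S\<^esub> \<ominus>\<^bsub>S\<^esub> ?y \<in> Units S"
      using p q j(1) by (intro arch.one_minus_left_zero_divisor[where b = ?b]) auto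
    then obtain n :: nat where "?y [^]\<^bsub>S\<^esub> n = \<zero>\<^bsub>S\<^esub>"
      using one_minus_skew_monom_unit[of "p i" "Suc i"] p by auto
    then have "?y = \<zero>\<^bsub>S\<^esub>"
      using red.reduced[of ?y n] p by simp
    then show False using i(1) by simp
  qed
qed

section \<open>Descent from R[x;\<alpha>] to R\<close>

lemma domain_base:
  assumes "nc_domain S"
  shows "nc_domain R"
proof
  interpret dom: nc_domain S by fact
  fix a b assume "a \<in> carrier R" "b \<in> carrier R" "a \<noteq> \<zero>" "b \<noteq> \<zero>"
  then show "a \<otimes> b \<noteq> \<zero>"
    using dom.nc_integral[of "skew_monom R a 0" "skew_monom R b 0"]
    by (simp add: skew_monom_mult[OF endo])
qed

text \<open>If \<alpha> kills a, then xa = \<alpha>(a)x = 0 with x nonzero, so a = 0; injectivity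
  follows by applying this to differences.\<close>

lemma domain_endo_inj:
  assumes "nc_domain S"
  shows "inj_on \<alpha> (carrier R)"
proof -
  interpret dom: nc_domain S by fact
  interpret hom: ring_hom_ring R R \<alpha>
    by (rule ring_hom_ringI2[OF ring_axioms ring_axioms endo])
  have ker: "a = \<zero>" if a: "a \<in> carrier R" "\<alpha> a = \<zero>" for a
  proof -
    have "skew_monom R \<one> 1 \<otimes>\<^bsub>S\<^esub> skew_monom R a 0 = \<zero>\<^bsub>S\<^esub>"
      using a by (simp add: skew_monom_mult[OF endo])
    then show ?thesis
      using dom.nc_integral[of "skew_monom R \<one> 1" "skew_monom R a 0"] a one_neq_zero by auto
  qed
  have "x = y" if "x \<in> carrier R" "y \<in> carrier R" "\<alpha> x = \<alpha> y" for x y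
  proof -
    have "x \<oplus> \<ominus> y = \<zero>" by (rule ker) (use that in \<open>simp_all add: r_neg\<close>)
    then show ?thesis using minus_equality[of x "\<ominus> y"] that by simp
  qed
  then show ?thesis by (rule inj_onI)
qed

text \<open>Viewing elements of R as constants respects powers and products and keeps nonunits
  nonunits, so a common multiple of all powers of a in R remains one in \<open>S\<close>.\<close>

lemma left_archimedean_base:
  assumes "left_archimedean_ring S"
  shows "left_archimedean_ring R"
proof
  interpret arch: left_archimedean_ring S by fact
  fix a assume a: "a \<in> carrier R - Units R"
  have "b = \<zero>" if b: "b \<in> (\<Inter>n\<in>{1::nat..}. a [^] n <# carrier R)" for b
  proof -
    have "skew_monom R b 0 \<in> skew_monom R a 0 [^]\<^bsub>S\<^esub> n <#\<^bsub>S\<^esub> carrier S" if "n \<in> {1..}" for n :: nat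
    proof -
      have "b \<in> a [^] n <# carrier R" using b that by blast
      then obtain h where h: "h \<in> carrier R" "b = a [^] n \<otimes> h"
        unfolding l_coset_def by blast
      then have "skew_monom R b 0 = skew_monom R a 0 [^]\<^bsub>S\<^esub> n \<otimes>\<^bsub>S\<^esub> skew_monom R h 0"
        using a by (simp add: skew_monom_0_pow skew_monom_mult[OF endo])
      then show ?thesis using h by (auto simp: l_coset_def)
    qed
    moreover have "skew_monom R a 0 \<in> carrier S - Units S"
      using a skew_monom_0_unit_iff by simp
    ultimately have "skew_monom R b 0 = \<zero>\<^bsub>S\<^esub>"
      using arch.left_archimedean by blast
    then show ?thesis by simp
  qed
  moreover have "\<zero> \<in> a [^] n <# carrier R" for n :: nat
    using a by (auto simp: l_coset_def intro!: bexI[of _ \<zero>])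
  ultimately show "(\<Inter>n\<in>{1::nat..}. a [^] n <# carrier R) = {\<zero>}"
    by blast
qed

section \<open>Ascent from R to R[x;\<alpha>]\<close>

lemma domain_extension:
  assumes "nc_domain R" and inj: "inj_on \<alpha> (carrier R)"
  shows "nc_domain S"
proof
  interpret dom: nc_domain R by fact
  fix p q assume p: "p \<in> carrier S" "p \<noteq> \<zero>\<^bsub>S\<^esub>" and q: "q \<in> carrier S" "q \<noteq> \<zero>\<^bsub>S\<^esub>"
  obtain i where i: "p i \<noteq> \<zero>" "\<And>k. k < i \<Longrightarrow> p k = \<zero>" using lowest_coeff[OF p(2)] by blast
  obtain j where j: "q j \<noteq> \<zero>" "\<And>k. k < j \<Longrightarrow> q k = \<zero>" using lowest_coeff[OF q(2)] by blast
  have "(p \<otimes>\<^bsub>S\<^esub> q) (i + j) \<noteq> \<zero>"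
    using lowest_coeff_mult[of p q i j] p q i j
    by (simp add: dom.nc_integral endo_pow_eq_zero_iff[OF inj])
  then show "p \<otimes>\<^bsub>S\<^esub> q \<noteq> \<zero>\<^bsub>S\<^esub>" by (auto simp: zero_S)
qed

text \<open>Leading coefficients multiply, up to powers of \<alpha>, to nonzero elements, so degrees
  add. Powers of a polynomial of positive degree therefore have unbounded degree.\<close>

lemma leading_coeff_pow:
  assumes "nc_domain R" and inj: "inj_on \<alpha> (carrier R)"
    and p: "p \<in> carrier S" "p d \<noteq> \<zero>" "\<And>k. d < k \<Longrightarrow> p k = \<zero>"
  shows "(p [^]\<^bsub>S\<^esub> n) (n * d) \<noteq> \<zero> \<and> (\<forall>k>n * d. (p [^]\<^bsub>S\<^esub> n) k = \<zero>)"
proof (induction n)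
  case 0
  then show ?case using one_neq_zero by (simp add: one_S skew_monom_def)
next
  case (Suc n)
  interpret dom: nc_domain R by fact
  have "(p [^]\<^bsub>S\<^esub> n \<otimes>\<^bsub>S\<^esub> p) (n * d + d) = (p [^]\<^bsub>S\<^esub> n) (n * d) \<otimes> (\<alpha> ^^ (n * d)) (p d)"
    using Suc p by (intro leading_coeff_mult(1)) auto
  moreover have "(p [^]\<^bsub>S\<^esub> n \<otimes>\<^bsub>S\<^esub> p) k = \<zero>" if "n * d + d < k" for k
    using Suc p that by (intro leading_coeff_mult(2)) auto
  ultimately show ?case
    using Suc p by (auto simp: dom.nc_integral endo_pow_eq_zero_iff[OF inj] add.commute)
qed

lemma left_archimedean_extension:
  assumes "left_archimedean_ring R" "nc_domain R" and inj: "inj_on \<alpha> (carrier R)"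
  shows "left_archimedean_ring S"
proof
  interpret arch: left_archimedean_ring R by fact
  interpret dom: nc_domain R by fact
  fix f assume "f \<in> carrier S - Units S"
  then have f: "f \<in> carrier S" "f \<notin> Units S" by auto
  have "g = \<zero>\<^bsub>S\<^esub>" if g: "g \<in> (\<Inter>n\<in>{1::nat..}. f [^]\<^bsub>S\<^esub> n <#\<^bsub>S\<^esub> carrier S)" for g
  proof (rule ccontr)
    assume g0: "g \<noteq> \<zero>\<^bsub>S\<^esub>"
    have multiple: "\<exists>h\<in>carrier S. g = f [^]\<^bsub>S\<^esub> n \<otimes>\<^bsub>S\<^esub> h" if "1 \<le> n" for n :: nat
      using g that by (auto simp: l_coset_def)
    then have gS: "g \<in> carrier S" using f by force
    have "f \<noteq> \<zero>\<^bsub>S\<^esub>" using multiple[of 1] g0 by auto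
    then obtain d where d: "f d \<noteq> \<zero>" "\<And>k. d < k \<Longrightarrow> f k = \<zero>"
      using leading_coeff f(1) by blast
    show False
    proof (cases "d = 0")
      \<comment> \<open>For constant f, left multiplication by powers of f acts coefficientwise.
        Each coefficient of g then lies in the intersection for the nonunit \<open>f 0\<close> of
        R.\<close>
      case True
      let ?a = "f 0"
      have fa: "f = skew_monom R ?a 0"
        using d True by (auto simp: skew_monom_def)
      have a: "?a \<in> carrier R - Units R"
        using f fa skew_monom_0_unit_iff[of ?a] by simp
      have "g k \<in> ?a [^] n <# carrier R" if n: "n \<in> {1..}" for k and n :: nat
      proof -
        obtain h where h: "h \<in> carrier S" "g = f [^]\<^bsub>S\<^esub> n \<otimes>\<^bsub>S\<^esub> h"
          using multiple[of n] n by auto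
        moreover have "f [^]\<^bsub>S\<^esub> n = skew_monom R (?a [^] n) 0"
          using a skew_monom_0_pow[of ?a n] fa by simp
        ultimately have "g k = ?a [^] n \<otimes> h k"
          using coeff_skew_monom_mult[of "?a [^] n" h 0 k] a by simp
        then show ?thesis using h by (auto simp: l_coset_def)
      qed
      then have "g k = \<zero>" for k
        using arch.left_archimedean[OF a] by blast
      then show False using g0 by (auto simp: zero_S)
    next
      case False
      obtain N where N: "\<And>k. N < k \<Longrightarrow> g k = \<zero>" using coeffs_bounded[OF gS] by blast
      \<comment> \<open>Since d is at least 1, the product of \<open>f [^] (N + 1)\<close> and h has
        degree (N + 1)d + e > N, where e is the degree of h. This contradicts the bound N on
        g.\<close>
      let ?n = "Suc N"
      obtain h where h: "h \<in> carrier S" "g = f [^]\<^bsub>S\<^esub> ?n \<otimes>\<^bsub>S\<^esub> h"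
        using multiple[of ?n] by auto
      have "h \<noteq> \<zero>\<^bsub>S\<^esub>" using h g0 f by auto
      then obtain e where e: "h e \<noteq> \<zero>" "\<And>k. e < k \<Longrightarrow> h k = \<zero>"
        using leading_coeff h(1) by blast
      note pow = leading_coeff_pow[OF assms(2) inj f(1) d, of ?n]
      have "g (?n * d + e) = (f [^]\<^bsub>S\<^esub> ?n) (?n * d) \<otimes> (\<alpha> ^^ (?n * d)) (h e)"
        unfolding h(2) by (rule leading_coeff_mult(1)) (use pow e f h(1) in blast)+
      moreover have "(f [^]\<^bsub>S\<^esub> ?n) (?n * d) \<in> carrier R"
        using f(1) by (intro coeff_closed S.nat_pow_closed)
      ultimately have "g (?n * d + e) \<noteq> \<zero>"
        using pow h(1) e(1) dom.nc_integral endo_pow_eq_zero_iff[OF inj] by simp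
      moreover have "N < ?n * d + e" using False by (cases d) auto
      ultimately show False using N by blast
    qed
  qed
  moreover have "\<zero>\<^bsub>S\<^esub> \<in> f [^]\<^bsub>S\<^esub> n <#\<^bsub>S\<^esub> carrier S" for n :: nat
    using f by (auto simp: l_coset_def intro!: bexI[of _ "\<zero>\<^bsub>S\<^esub>"])
  ultimately show "(\<Inter>n\<in>{1::nat..}. f [^]\<^bsub>S\<^esub> n <#\<^bsub>S\<^esub> carrier S) = {\<zero>\<^bsub>S\<^esub>}"
    by blast
qed

end

theorem theorem3p4:
  fixes R :: "('a, 'm) ring_scheme" and \<alpha> :: "'a \<Rightarrow> 'a"
  assumes "nonzero_ring R" and "\<alpha> \<in> ring_hom R R"
  shows "((reduced_ring (skew_poly_ring R \<alpha>) \<and> left_archimedean_ring (skew_poly_ring R \<alpha>)) \<longleftrightarrow>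
            (left_archimedean_ring (skew_poly_ring R \<alpha>) \<and> nc_domain (skew_poly_ring R \<alpha>)))
       \<and> ((left_archimedean_ring (skew_poly_ring R \<alpha>) \<and> nc_domain (skew_poly_ring R \<alpha>)) \<longleftrightarrow>
            (left_archimedean_ring R \<and> nc_domain R \<and> inj_on \<alpha> (carrier R)))"
proof -
  interpret skew_poly R \<alpha>
    using assms by (simp add: skew_poly_def skew_poly_axioms_def)
  show ?thesis
    using reduced_left_archimedean_imp_domain nc_domain.reduced_ring[of S]
      left_archimedean_base domain_base domain_endo_inj
      left_archimedean_extension domain_extension
    by blast
qed

end
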